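(* Let $I$ be a nonempty partially ordered set and $A$ a unital ring. Consider the groupoid $\Gamma:=I\times I$ and the $\Gamma$-graded ring $R:=\mathrm{UT}_I(A)$. Let $\mathrm{rad}(A)$ be the Jacobson radical of $A$. The following assertions hold: (1) $\mathrm{rad}^{\mathrm{gr}}(R)$ is gr-nil if and only if $\mathrm{rad}(A)$ is nil. (2) $\mathrm{rad}^{\mathrm{gr}}(R)$ is $\Gamma_0$-nilpotent if and only if $\mathrm{rad}(A)$ is nilpotent. (3) $\mathrm{rad}^{\mathrm{gr}}(R)$ is right objectwise nilpotent if and only if $\mathrm{rad}(A)$ is nilpotent and, for each $i\in I$, there exists $n_i\in\mathbb{N}$ such that $I$ contains no chains of the form $i<k_1<k_2<\cdots<k_{n_i}$. (4) $\mathrm{rad}^{\mathrm{gr}}(R)$ is left objectwise nilpotent if and only if $\mathrm{rad}(A)$ is nilpotent and, for each $j\in I$, there exists $n_j\in\mathbb{N}$ such that $I$ contains no chains of the form $k_1<k_2<\cdots<k_{n_j}<j$. (5) $\mathrm{rad}^{\mathrm{gr}}(R)$ is nilpotent if and only if $\mathrm{rad}(A)$ is nilpotent and there exists $t\in\mathbb{N}$ such that $I$ contains no chains of the form $k_0<k_1<\cdots<k_t$.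
   Context: For a nonempty set $I$, $\Gamma=I\times I$ is a groupoid with $(k,j)(j,i)=(k,i)$ (other products undefined), and $\Gamma_0=\{(i,i):i\in I\}$. For a unital ring $A$, $\mathrm{M}_I(A)$ is the ring of $I\times I$ matrices over $A$ with finitely many nonzero entries; for $I$ partially ordered, $\mathrm{UT}_I(A)$ is the subring of matrices $(a_{ij})_{ij}$ with $a_{ij}=0$ whenever $i\not\le j$. It is $\Gamma$-graded: for $R=\mathrm{UT}_I(A)$, $R_{(i,j)}=AE_{ij}$ if $i\le j$ and $R_{(i,j)}=0$ otherwise ($E_{ij}$ the elementary matrix); put $1_e=E_{ii}$ for $e=(i,i)$. Homogeneous elements are the elements of $\bigcup_{\gamma}R_\gamma$. A one- or two-sided ideal $U$ of $R$ is graded if $U=\bigoplus_{\gamma}(U\cap R_\gamma)$. $\mathrm{rad}^{\mathrm{gr}}(R)$ is the intersection of all gr-maximal graded right ideals of $R$ (those maximal among proper graded right ideals); it is a graded two-sided ideal. A graded ideal $U$ is: gr-nil if every homogeneous element of $U$ is nilpotent; nilpotent if $U^n=0$ for some positive integer $n$; $\Gamma_0$-nilpotent if for each $e\in\Gamma_0$ there is a positive integer $n_e$ with $(1_eU)^{n_e}=0$ (equivalently, each $1_eU1_e$ is nilpotent); right (resp. left) objectwise nilpotent if for each $e\in\Gamma_0$ there is a positive integer $n_e$ with $1_eU^{n_e}=0$ (resp. $U^{n_e}1_e=0$). *)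

theory Defs
  imports Main
begin

subsection \<open>One-sided ideals and products in not necessarily unital rings\<close>

text \<open>
  A ring here is a subring \<open>R\<close> of a type of class \<open>ring\<close> (no unit required), so
  that the same notions apply to \<open>UT\<^sub>I(A)\<close>, which has no unit if \<open>I\<close> is infinite, and
  to \<open>A\<close> itself, taking \<open>R = UNIV\<close>.
\<close>

definition subring :: "'r::ring set \<Rightarrow> bool" where
  "subring R \<longleftrightarrow>
     0 \<in> R \<and> (\<forall>x\<in>R. \<forall>y\<in>R. x + y \<in> R \<and> x * y \<in> R) \<and> (\<forall>x\<in>R. - x \<in> R)"

definition right_ideal :: "'r::ring set \<Rightarrow> 'r set \<Rightarrow> bool" where
  "right_ideal R U \<longleftrightarrow>
     U \<subseteq> R \<and> 0 \<in> U \<and> (\<forall>x\<in>U. \<forall>y\<in>U. x + y \<in> U) \<and> (\<forall>x\<in>U. - x \<in> U) \<and>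
     (\<forall>x\<in>U. \<forall>r\<in>R. x * r \<in> U)"

definition maximal_right_ideal :: "'r::ring set \<Rightarrow> 'r set \<Rightarrow> bool" where
  "maximal_right_ideal R M \<longleftrightarrow>
     right_ideal R M \<and> M \<noteq> R \<and>
     (\<forall>N. right_ideal R N \<and> N \<noteq> R \<and> M \<subseteq> N \<longrightarrow> N = M)"

definition jacobson_radical :: "'a::ring_1 set" where
  "jacobson_radical = \<Inter> {M. maximal_right_ideal UNIV M}"

text \<open>\<open>UV\<close> is the additive subgroup generated by the products \<open>u v\<close>.\<close>

inductive_set set_mult :: "'r::ring set \<Rightarrow> 'r set \<Rightarrow> 'r set" for U V where
  zero: "0 \<in> set_mult U V"
| prod: "u \<in> U \<Longrightarrow> v \<in> V \<Longrightarrow> u * v \<in> set_mult U V"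
| add: "x \<in> set_mult U V \<Longrightarrow> y \<in> set_mult U V \<Longrightarrow> x + y \<in> set_mult U V"
| uminus: "x \<in> set_mult U V \<Longrightarrow> - x \<in> set_mult U V"

text \<open>
  Without a unit there is no zeroth power, so exponents are shifted:
  \<open>pow_Suc x n\<close> is \<open>x\<^sup>n\<^sup>+\<^sup>1\<close> and \<open>set_pow_Suc U n\<close> is \<open>U\<^sup>n\<^sup>+\<^sup>1\<close>. Thus the
  positive exponents are \<open>n + 1\<close> with \<open>n\<close> ranging over all of \<open>nat\<close>.
\<close>

primrec pow_Suc :: "'r::ring \<Rightarrow> nat \<Rightarrow> 'r" where
  "pow_Suc x 0 = x"
| "pow_Suc x (Suc n) = pow_Suc x n * x"

primrec set_pow_Suc :: "'r::ring set \<Rightarrow> nat \<Rightarrow> 'r set" where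
  "set_pow_Suc U 0 = U"
| "set_pow_Suc U (Suc n) = set_mult (set_pow_Suc U n) U"

definition nilpotent_element :: "'r::ring \<Rightarrow> bool" where
  "nilpotent_element x \<longleftrightarrow> (\<exists>n. pow_Suc x n = 0)"

definition nil_ideal :: "'r::ring set \<Rightarrow> bool" where
  "nil_ideal U \<longleftrightarrow> (\<forall>x\<in>U. nilpotent_element x)"

definition nilpotent_ideal :: "'r::ring set \<Rightarrow> bool" where
  "nilpotent_ideal U \<longleftrightarrow> (\<exists>n. set_pow_Suc U n = {0})"


subsection \<open>Groupoid-graded rings\<close>

text \<open>\<open>U\<close> is the internal direct sum of the \<open>X \<gamma>\<close>: summation of finitely supported
  families is a bijection onto \<open>U\<close>.\<close>

definition internal_direct_sum :: "('g \<Rightarrow> 'r::ring set) \<Rightarrow> 'r set \<Rightarrow> bool" where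
  "internal_direct_sum X U \<longleftrightarrow>
     bij_betw (\<lambda>f. \<Sum>\<gamma> | f \<gamma> \<noteq> 0. f \<gamma>) {f. finite {\<gamma>. f \<gamma> \<noteq> 0} \<and> (\<forall>\<gamma>. f \<gamma> \<in> X \<gamma>)} U"

text \<open>
  The groupoid is given by a partial composition on the whole type \<open>'g\<close>, where
  \<open>None\<close> stands for an undefined product; \<open>G \<gamma>\<close> is the component \<open>R\<^sub>\<gamma>\<close>.
\<close>

definition groupoid_grading ::
    "('g \<Rightarrow> 'g \<Rightarrow> 'g option) \<Rightarrow> ('g \<Rightarrow> 'r::ring set) \<Rightarrow> 'r set \<Rightarrow> bool" where
  "groupoid_grading cmp G R \<longleftrightarrow>
     subring R \<and> internal_direct_sum G R \<and>
     (\<forall>\<gamma>. 0 \<in> G \<gamma> \<and> (\<forall>x\<in>G \<gamma>. \<forall>y\<in>G \<gamma>. x + y \<in> G \<gamma>) \<and> (\<forall>x\<in>G \<gamma>. - x \<in> G \<gamma>)) \<and>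
     (\<forall>\<gamma> \<delta>. \<forall>x\<in>G \<gamma>. \<forall>y\<in>G \<delta>.
        case cmp \<gamma> \<delta> of None \<Rightarrow> x * y = 0 | Some \<epsilon> \<Rightarrow> x * y \<in> G \<epsilon>)"

definition homogeneous :: "('g \<Rightarrow> 'r::ring set) \<Rightarrow> 'r \<Rightarrow> bool" where
  "homogeneous G x \<longleftrightarrow> x \<in> (\<Union>\<gamma>. G \<gamma>)"

definition graded_subset :: "('g \<Rightarrow> 'r::ring set) \<Rightarrow> 'r set \<Rightarrow> bool" where
  "graded_subset G U \<longleftrightarrow> internal_direct_sum (\<lambda>\<gamma>. U \<inter> G \<gamma>) U"

definition graded_right_ideal ::
    "('g \<Rightarrow> 'r::ring set) \<Rightarrow> 'r set \<Rightarrow> 'r set \<Rightarrow> bool" where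
  "graded_right_ideal G R U \<longleftrightarrow> right_ideal R U \<and> graded_subset G U"

definition gr_maximal_right_ideal ::
    "('g \<Rightarrow> 'r::ring set) \<Rightarrow> 'r set \<Rightarrow> 'r set \<Rightarrow> bool" where
  "gr_maximal_right_ideal G R M \<longleftrightarrow>
     graded_right_ideal G R M \<and> M \<noteq> R \<and>
     (\<forall>N. graded_right_ideal G R N \<and> N \<noteq> R \<and> M \<subseteq> N \<longrightarrow> N = M)"

text \<open>Intersecting with \<open>R\<close> only matters if there are no gr-maximal right ideals.\<close>

definition gr_radical :: "('g \<Rightarrow> 'r::ring set) \<Rightarrow> 'r set \<Rightarrow> 'r set" where
  "gr_radical G R = R \<inter> \<Inter> {M. gr_maximal_right_ideal G R M}"

definition gr_nil :: "('g \<Rightarrow> 'r::ring set) \<Rightarrow> 'r set \<Rightarrow> bool" where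
  "gr_nil G U \<longleftrightarrow> (\<forall>x\<in>U. homogeneous G x \<longrightarrow> nilpotent_element x)"

text \<open>Below, \<open>\<Gamma>\<^sub>0\<close> is the set of objects of the groupoid and \<open>u e\<close> is \<open>1\<^sub>e\<close>.\<close>

definition \<Gamma>\<^sub>0_nilpotent :: "'g set \<Rightarrow> ('g \<Rightarrow> 'r::ring) \<Rightarrow> 'r set \<Rightarrow> bool" where
  "\<Gamma>\<^sub>0_nilpotent \<Gamma>\<^sub>0 u U \<longleftrightarrow> (\<forall>e\<in>\<Gamma>\<^sub>0. \<exists>n. set_pow_Suc ((\<lambda>x. u e * x) ` U) n = {0})"

definition right_objectwise_nilpotent :: "'g set \<Rightarrow> ('g \<Rightarrow> 'r::ring) \<Rightarrow> 'r set \<Rightarrow> bool" where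
  "right_objectwise_nilpotent \<Gamma>\<^sub>0 u U \<longleftrightarrow>
     (\<forall>e\<in>\<Gamma>\<^sub>0. \<exists>n. (\<lambda>x. u e * x) ` set_pow_Suc U n = {0})"

definition left_objectwise_nilpotent :: "'g set \<Rightarrow> ('g \<Rightarrow> 'r::ring) \<Rightarrow> 'r set \<Rightarrow> bool" where
  "left_objectwise_nilpotent \<Gamma>\<^sub>0 u U \<longleftrightarrow>
     (\<forall>e\<in>\<Gamma>\<^sub>0. \<exists>n. (\<lambda>x. x * u e) ` set_pow_Suc U n = {0})"


subsection \<open>The ring \<open>M\<^sub>I(A)\<close> of finitely supported matrices\<close>

typedef (overloaded) ('i, 'a) fmat =
    "{M :: 'i \<Rightarrow> 'i \<Rightarrow> 'a::zero. finite {(i, j). M i j \<noteq> 0}}"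
  morphisms entry Abs_fmat
  by (rule exI[of _ "\<lambda>_ _. 0"]) simp

setup_lifting type_definition_fmat

lemma fmat_eqI: "(\<And>i j. entry M i j = entry N i j) \<Longrightarrow> M = N"
  by (metis entry_inject ext)

lemma finite_entry: "finite {(i, j). entry M i j \<noteq> 0}"
  using entry[of M] by simp

lemma finite_entry_row: "finite {k. entry M i k \<noteq> 0}"
proof -
  have "{k. entry M i k \<noteq> 0} \<subseteq> snd ` {(i, j). entry M i j \<noteq> 0}" by force
  then show ?thesis using finite_entry finite_surj by blast
qed

instantiation fmat :: (type, ring) ring
begin

lift_definition zero_fmat :: "('a, 'b) fmat" is "\<lambda>_ _. 0" by simp

lift_definition plus_fmat :: "('a, 'b) fmat \<Rightarrow> ('a, 'b) fmat \<Rightarrow> ('a, 'b) fmat"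
  is "\<lambda>M N i j. M i j + N i j"
  subgoal for M N
    by (rule finite_subset[of _ "{(i, j). M i j \<noteq> 0} \<union> {(i, j). N i j \<noteq> 0}"]) auto
  done

lift_definition uminus_fmat :: "('a, 'b) fmat \<Rightarrow> ('a, 'b) fmat"
  is "\<lambda>M i j. - M i j" by simp

lift_definition minus_fmat :: "('a, 'b) fmat \<Rightarrow> ('a, 'b) fmat \<Rightarrow> ('a, 'b) fmat"
  is "\<lambda>M N i j. M i j - N i j"
  subgoal for M N
    by (rule finite_subset[of _ "{(i, j). M i j \<noteq> 0} \<union> {(i, j). N i j \<noteq> 0}"]) auto
  done

lift_definition times_fmat :: "('a, 'b) fmat \<Rightarrow> ('a, 'b) fmat \<Rightarrow> ('a, 'b) fmat"
  is "\<lambda>M N i j. \<Sum>k | M i k \<noteq> 0. M i k * N k j"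
  subgoal for M N
  proof -
    assume fin: "finite {(i, j). M i j \<noteq> 0}" "finite {(i, j). N i j \<noteq> 0}"
    have "{(i, j). (\<Sum>k | M i k \<noteq> 0. M i k * N k j) \<noteq> 0}
            \<subseteq> fst ` {(i, j). M i j \<noteq> 0} \<times> snd ` {(i, j). N i j \<noteq> 0}"
    proof safe
      fix i j assume "(\<Sum>k | M i k \<noteq> 0. M i k * N k j) \<noteq> 0"
      then obtain k where "M i k * N k j \<noteq> 0"
        using sum.not_neutral_contains_not_neutral by blast
      then have "M i k \<noteq> 0" "N k j \<noteq> 0" by auto
      then show "i \<in> fst ` {(i, j). M i j \<noteq> 0}" "j \<in> snd ` {(i, j). N i j \<noteq> 0}"
        by force+
    qed
    then show ?thesis using fin by (meson finite_SigmaI finite_imageI finite_subset)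
  qed
  done

lemma entry_times_superset:
  fixes M N :: "('a, 'b) fmat"
  assumes "finite K" "{k. entry M i k \<noteq> 0} \<subseteq> K"
  shows "entry (M * N) i j = (\<Sum>k\<in>K. entry M i k * entry N k j)"
  unfolding times_fmat.rep_eq using assms by (intro sum.mono_neutral_left) auto

instance
proof
  fix L M N :: "('a, 'b) fmat"
  show "L * M * N = L * (M * N)"
  proof (rule fmat_eqI)
    fix i j
    define K where "K = {k. entry L i k \<noteq> 0}"
    define K' where "K' = snd ` {(i, j). entry M i j \<noteq> 0}"
    have K: "finite K" unfolding K_def by (rule finite_entry_row)
    have K': "finite K'" unfolding K'_def using finite_entry by blast
    have M: "{k'. entry M k k' \<noteq> 0} \<subseteq> K'" for k unfolding K'_def by force
    have LM: "entry (L * M) i k' = (\<Sum>k\<in>K. entry L i k * entry M k k')" for k'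
      using K by (intro entry_times_superset) (auto simp: K_def)
    have "{k'. entry (L * M) i k' \<noteq> 0} \<subseteq> K'"
    proof
      fix k' assume "k' \<in> {k'. entry (L * M) i k' \<noteq> 0}"
      then have "(\<Sum>k\<in>K. entry L i k * entry M k k') \<noteq> 0" using LM by simp
      then obtain k where "entry M k k' \<noteq> 0"
        by (metis (mono_tags, lifting) mult_zero_right sum.neutral)
      then show "k' \<in> K'" using M by blast
    qed
    then have "entry (L * M * N) i j = (\<Sum>k'\<in>K'. entry (L * M) i k' * entry N k' j)"
      using K' by (intro entry_times_superset)
    also have "\<dots> = (\<Sum>k'\<in>K'. \<Sum>k\<in>K. entry L i k * (entry M k k' * entry N k' j))"
      by (simp add: LM sum_distrib_right mult.assoc)
    also have "\<dots> = (\<Sum>k\<in>K. \<Sum>k'\<in>K'. entry L i k * (entry M k k' * entry N k' j))"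
      by (rule sum.swap)
    also have "\<dots> = (\<Sum>k\<in>K. entry L i k * entry (M * N) k j)"
      using entry_times_superset[OF K' M] by (simp add: sum_distrib_left)
    also have "\<dots> = entry (L * (M * N)) i j"
      using K by (intro entry_times_superset[symmetric]) (auto simp: K_def)
    finally show "entry (L * M * N) i j = entry (L * (M * N)) i j" .
  qed
  show "(L + M) * N = L * N + M * N"
  proof (rule fmat_eqI)
    fix i j
    define K where "K = {k. entry L i k \<noteq> 0} \<union> {k. entry M i k \<noteq> 0}"
    have K: "finite K" unfolding K_def by (simp add: finite_entry_row)
    have "entry ((L + M) * N) i j = (\<Sum>k\<in>K. entry (L + M) i k * entry N k j)"
      by (intro entry_times_superset K) (auto simp: K_def plus_fmat.rep_eq)
    moreover have "entry (L * N) i j = (\<Sum>k\<in>K. entry L i k * entry N k j)"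
      by (intro entry_times_superset K) (auto simp: K_def)
    moreover have "entry (M * N) i j = (\<Sum>k\<in>K. entry M i k * entry N k j)"
      by (intro entry_times_superset K) (auto simp: K_def)
    ultimately show "entry ((L + M) * N) i j = entry (L * N + M * N) i j"
      by (simp add: plus_fmat.rep_eq distrib_right sum.distrib)
  qed
  show "L * (M + N) = L * M + L * N"
    by (rule fmat_eqI)
      (simp add: plus_fmat.rep_eq times_fmat.rep_eq distrib_left sum.distrib)
qed (rule fmat_eqI,
     simp add: plus_fmat.rep_eq uminus_fmat.rep_eq minus_fmat.rep_eq zero_fmat.rep_eq
       algebra_simps)+

end

text \<open>\<open>elem_mat a i j\<close> is \<open>a E\<^sub>i\<^sub>j\<close>.\<close>

lift_definition elem_mat :: "'a::zero \<Rightarrow> 'i \<Rightarrow> 'i \<Rightarrow> ('i, 'a) fmat"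
  is "\<lambda>a i j i' j'. if i' = i \<and> j' = j then a else 0"
  subgoal for a i j by (rule finite_subset[of _ "{(i, j)}"]) auto
  done


subsection \<open>The graded ring \<open>UT\<^sub>I(A)\<close>\<close>

text \<open>
  The poset \<open>I\<close> is a type of class \<open>order\<close>, and \<open>A\<close> a type of class \<open>ring_1\<close>; in
  particular \<open>1 \<noteq> 0\<close> in \<open>A\<close>. The groupoid \<open>\<Gamma> = I \<times> I\<close> is the type \<open>'i \<times> 'i\<close>.
\<close>

definition UT :: "('i::order, 'a::ring_1) fmat set" where
  "UT = {M. \<forall>i j. \<not> i \<le> j \<longrightarrow> entry M i j = 0}"

fun pair_comp :: "'i \<times> 'i \<Rightarrow> 'i \<times> 'i \<Rightarrow> ('i \<times> 'i) option" where
  "pair_comp (k, j) (j', i) = (if j = j' then Some (k, i) else None)"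

definition pair_objects :: "('i \<times> 'i) set" where
  "pair_objects = {(i, i) | i. True}"

definition UT_comp :: "'i \<times> 'i \<Rightarrow> ('i::order, 'a::ring_1) fmat set" where
  "UT_comp = (\<lambda>(i, j). if i \<le> j then {elem_mat a i j | a. True} else {0})"

definition UT_one :: "'i \<times> 'i \<Rightarrow> ('i::order, 'a::ring_1) fmat" where
  "UT_one = (\<lambda>(i, j). elem_mat 1 i j)"

lemma subring_UT: "subring (UT :: ('i::order, 'a::ring_1) fmat set)"
proof -
  have "entry (M * N) i j = 0"
    if "M \<in> UT" "N \<in> UT" "\<not> i \<le> j" for M N :: "('i, 'a) fmat" and i j
    unfolding times_fmat.rep_eq
  proof (intro sum.neutral ballI)
    fix k assume "k \<in> {k. entry M i k \<noteq> 0}"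
    then have "i \<le> k" using that(1) by (auto simp: UT_def)
    then have "\<not> k \<le> j" using that(3) order_trans by blast
    then show "entry M i k * entry N k j = 0" using that(2) by (simp add: UT_def)
  qed
  then show ?thesis
    by (auto simp: subring_def UT_def plus_fmat.rep_eq uminus_fmat.rep_eq zero_fmat.rep_eq)
qed

lemma UT_comp_iff:
  "M \<in> UT_comp (i, j) \<longleftrightarrow>
     (\<forall>i' j'. entry M i' j' \<noteq> 0 \<longrightarrow> i' = i \<and> j' = j \<and> i \<le> j)"
proof
  assume "M \<in> UT_comp (i, j)"
  then show "\<forall>i' j'. entry M i' j' \<noteq> 0 \<longrightarrow> i' = i \<and> j' = j \<and> i \<le> j"
    by (auto simp: UT_comp_def elem_mat.rep_eq zero_fmat.rep_eq split: if_splits)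
next
  assume *: "\<forall>i' j'. entry M i' j' \<noteq> 0 \<longrightarrow> i' = i \<and> j' = j \<and> i \<le> j"
  show "M \<in> UT_comp (i, j)"
  proof (cases "i \<le> j")
    case True
    have "M = elem_mat (entry M i j) i j"
      by (rule fmat_eqI) (use * in \<open>auto simp: elem_mat.rep_eq\<close>)
    then show ?thesis using True by (auto simp: UT_comp_def)
  next
    case False
    have "M = 0" by (rule fmat_eqI) (use * False in \<open>auto simp: zero_fmat.rep_eq\<close>)
    then show ?thesis using False by (simp add: UT_comp_def)
  qed
qed

lemma entry_sum: "entry (sum f S) i j = (\<Sum>s\<in>S. entry (f s) i j)"
  by (induction S rule: infinite_finite_induct) (auto simp: zero_fmat.rep_eq plus_fmat.rep_eq)

lemma entry_sum_UT_comp: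
  fixes f :: "'i \<times> 'i \<Rightarrow> ('i::order, 'a::ring_1) fmat"
  assumes "finite {\<gamma>. f \<gamma> \<noteq> 0}" "\<And>\<gamma>. f \<gamma> \<in> UT_comp \<gamma>"
  shows "entry (\<Sum>\<gamma> | f \<gamma> \<noteq> 0. f \<gamma>) i j = entry (f (i, j)) i j"
proof -
  have "entry (f \<gamma>) i j = 0" if "\<gamma> \<noteq> (i, j)" for \<gamma>
    using assms(2)[of \<gamma>] that by (cases \<gamma>) (auto simp: UT_comp_iff)
  then have "(\<Sum>\<gamma> | f \<gamma> \<noteq> 0. entry (f \<gamma>) i j)
      = (\<Sum>\<gamma> | f \<gamma> \<noteq> 0. if (i, j) = \<gamma> then entry (f (i, j)) i j else 0)"
    by (intro sum.cong) auto
  also have "\<dots> = entry (f (i, j)) i j"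
    using assms(1) by (simp add: sum.delta zero_fmat.rep_eq)
  finally show ?thesis by (simp add: entry_sum)
qed

lemma internal_direct_sum_UT:
  "internal_direct_sum UT_comp (UT :: ('i::order, 'a::ring_1) fmat set)"
  unfolding internal_direct_sum_def
proof (rule bij_betw_imageI)
  let ?F = "{f :: 'i \<times> 'i \<Rightarrow> ('i, 'a) fmat. finite {\<gamma>. f \<gamma> \<noteq> 0} \<and> (\<forall>\<gamma>. f \<gamma> \<in> UT_comp \<gamma>)}"
  let ?s = "\<lambda>f :: 'i \<times> 'i \<Rightarrow> ('i, 'a) fmat. \<Sum>\<gamma> | f \<gamma> \<noteq> 0. f \<gamma>"
  show "inj_on ?s ?F"
  proof (rule inj_onI)
    fix f g assume f: "f \<in> ?F" and g: "g \<in> ?F" and eq: "?s f = ?s g"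
    show "f = g"
    proof
      fix \<gamma> :: "'i \<times> 'i"
      obtain i j where \<gamma>: "\<gamma> = (i, j)" by (cases \<gamma>)
      have *: "entry (f \<gamma>) i j = entry (g \<gamma>) i j"
        using entry_sum_UT_comp[of f i j] entry_sum_UT_comp[of g i j] f g eq \<gamma>
        by (metis (no_types, lifting) mem_Collect_eq)
      have fg: "f (i, j) \<in> UT_comp (i, j)" "g (i, j) \<in> UT_comp (i, j)" using f g by blast+
      show "f \<gamma> = g \<gamma>"
      proof (rule fmat_eqI)
        fix i' j'
        show "entry (f \<gamma>) i' j' = entry (g \<gamma>) i' j'"
          using * fg unfolding UT_comp_iff \<gamma> by (cases "i' = i \<and> j' = j") metis+
      qed
    qed
  qed
  show "?s ` ?F = UT"
  proof
    show "?s ` ?F \<subseteq> UT"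
    proof
      fix M assume "M \<in> ?s ` ?F"
      then obtain f where f: "f \<in> ?F" and M: "M = ?s f" by blast
      have "entry M i j = 0" if "\<not> i \<le> j" for i j
      proof -
        have "f (i, j) \<in> UT_comp (i, j)" using f by blast
        then have "entry (f (i, j)) i j = 0" using that unfolding UT_comp_iff by blast
        then show ?thesis using entry_sum_UT_comp[of f i j] f M
          by (metis (no_types, lifting) mem_Collect_eq)
      qed
      then show "M \<in> UT" by (simp add: UT_def)
    qed
    show "UT \<subseteq> ?s ` ?F"
    proof
      fix M :: "('i, 'a) fmat" assume M: "M \<in> UT"
      define f where "f = (\<lambda>(i, j). elem_mat (entry M i j) i j)"
      have "{\<gamma>. f \<gamma> \<noteq> 0} \<subseteq> {(i, j). entry M i j \<noteq> 0}"
      proof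
        fix \<gamma> assume "\<gamma> \<in> {\<gamma>. f \<gamma> \<noteq> 0}"
        moreover have "elem_mat (0 :: 'a) i j = 0" for i j :: 'i
          by (rule fmat_eqI) (simp add: elem_mat.rep_eq zero_fmat.rep_eq)
        ultimately show "\<gamma> \<in> {(i, j). entry M i j \<noteq> 0}" by (auto simp: f_def)
      qed
      then have fin: "finite {\<gamma>. f \<gamma> \<noteq> 0}" using finite_entry finite_subset by blast
      have compon: "f \<gamma> \<in> UT_comp \<gamma>" for \<gamma>
      proof (cases \<gamma>)
        case (Pair i j)
        then show ?thesis using M
          by (auto simp: f_def UT_comp_iff elem_mat.rep_eq UT_def)
      qed
      have "M = ?s f"
        by (rule fmat_eqI) (subst entry_sum_UT_comp[OF fin compon], simp add: f_def elem_mat.rep_eq)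
      then show "M \<in> ?s ` ?F" using fin compon by blast
    qed
  qed
qed

lemma groupoid_grading_UT:
  "groupoid_grading pair_comp UT_comp (UT :: ('i::order, 'a::ring_1) fmat set)"
  unfolding groupoid_grading_def
proof (intro conjI allI ballI)
  fix \<gamma> :: "'i \<times> 'i" and x y :: "('i, 'a) fmat"
  show "(0 :: ('i, 'a) fmat) \<in> UT_comp \<gamma>"
    by (cases \<gamma>) (simp add: UT_comp_iff zero_fmat.rep_eq)
  show "- x \<in> UT_comp \<gamma>" if "x \<in> UT_comp \<gamma>"
    using that by (cases \<gamma>) (simp only: UT_comp_iff uminus_fmat.rep_eq neg_equal_0_iff_equal)
  show "x + y \<in> UT_comp \<gamma>" if "x \<in> UT_comp \<gamma>" "y \<in> UT_comp \<gamma>"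
    using that by (cases \<gamma>) (simp add: UT_comp_iff plus_fmat.rep_eq, metis add.right_neutral)
next
  fix \<gamma> \<delta> :: "'i \<times> 'i" and x y :: "('i, 'a) fmat"
  assume x: "x \<in> UT_comp \<gamma>" and y: "y \<in> UT_comp \<delta>"
  obtain i j k l where [simp]: "\<gamma> = (i, j)" "\<delta> = (k, l)" by (cases \<gamma>, cases \<delta>)
  have nz: "j = k \<and> i' = i \<and> l' = l \<and> i \<le> l" if xy: "entry (x * y) i' l' \<noteq> 0" for i' l'
  proof -
    obtain m where "entry x i' m * entry y m l' \<noteq> 0"
      using xy sum.not_neutral_contains_not_neutral unfolding times_fmat.rep_eq by blast
    then have "entry x i' m \<noteq> 0" "entry y m l' \<noteq> 0" by auto
    then have "i' = i \<and> m = j \<and> i \<le> j" "m = k \<and> l' = l \<and> k \<le> l"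
      using x y unfolding \<open>\<gamma> = (i, j)\<close> \<open>\<delta> = (k, l)\<close> UT_comp_iff by blast+
    then show ?thesis using order_trans by blast
  qed
  show "case pair_comp \<gamma> \<delta> of None \<Rightarrow> x * y = 0 | Some \<epsilon> \<Rightarrow> x * y \<in> UT_comp \<epsilon>"
  proof (cases "j = k")
    case True
    then show ?thesis using nz by (auto simp: UT_comp_iff)
  next
    case False
    then have "x * y = 0" using nz by (intro fmat_eqI) (auto simp: zero_fmat.rep_eq)
    then show ?thesis using False by simp
  qed
qed (rule subring_UT internal_direct_sum_UT)+

end

(* A graded right ideal is determined by the entries it allows at each position. If it is proper,
   it misses some E_kk, so it lies in the proper graded right ideal of all x whose (k,k) entry is
   allowed. Hence the gr-maximal ones are exactly the {x. x_kk in m} with m a maximal right ideal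
   of A, and the graded radical U consists of the upper triangular matrices with diagonal in rad(A).
   A nonzero product of N elements of U follows a weakly increasing path; between two strict steps
   it picks up a power of rad(A), so chain bounds and nilpotency of rad(A) bound N.  Conversely
   the products a_1 ... a_N E_ii with a_1, ..., a_N in rad(A), and E_(k_0,k_1) ... E_(k_(N-1),k_N)
   for a chain k_0 < ... < k_N, lie in the N-th power of U. *)

theory Submission
  imports Defs
begin

subsection \<open>Products and powers of sets\<close>

text \<open>\<open>set_mult U V\<close> is the least additive subgroup containing the products, so
  an inclusion only has to be checked on products.\<close>

lemma set_mult_subset:
  assumes "0 \<in> W" "\<And>x y. x \<in> W \<Longrightarrow> y \<in> W \<Longrightarrow> x + y \<in> W" "\<And>x. x \<in> W \<Longrightarrow> - x \<in> W"
    and "\<And>u v. u \<in> U \<Longrightarrow> v \<in> V \<Longrightarrow> u * v \<in> W"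
  shows "set_mult U V \<subseteq> W"
proof
  fix x assume "x \<in> set_mult U V"
  then show "x \<in> W" by induction (use assms in auto)
qed

text \<open>Associativity moves the brackets on generating products; distributivity extends this to
  sums and negatives with \<open>w\<close> fixed.\<close>

lemma set_mult_assoc_subset: "set_mult (set_mult U V) W \<subseteq> set_mult U (set_mult V W)"
proof (rule set_mult_subset)
  fix x w assume "x \<in> set_mult U V" and w: "w \<in> W"
  then show "x * w \<in> set_mult U (set_mult V W)"
  proof induction
    case (prod u v)
    then show ?case using w by (simp add: mult.assoc set_mult.prod)
  qed (simp_all add: set_mult.intros distrib_right flip: minus_mult_left)
qed (rule set_mult.intros; assumption)+

lemma set_mult_mono: "U \<subseteq> U' \<Longrightarrow> V \<subseteq> V' \<Longrightarrow> set_mult U V \<subseteq> set_mult U' V'"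
  by (rule set_mult_subset) (auto intro: set_mult.intros)

text \<open>In ordinary exponents this is m + n + 2 = (m + 1) + (n + 1). The recursion only peels
  single factors off the right; with this form a whole block can be cut off at either end.\<close>

lemma set_pow_Suc_add_subset:
  "set_pow_Suc U (Suc (m + n)) \<subseteq> set_mult (set_pow_Suc U m) (set_pow_Suc U n)"
proof (induction n)
  case (Suc n)
  have "set_pow_Suc U (Suc (m + Suc n)) = set_mult (set_pow_Suc U (Suc (m + n))) U"
    by simp
  also have "\<dots> \<subseteq> set_mult (set_mult (set_pow_Suc U m) (set_pow_Suc U n)) U"
    using Suc by (intro set_mult_mono) auto
  also have "\<dots> \<subseteq> set_mult (set_pow_Suc U m) (set_pow_Suc U (Suc n))"
    using set_mult_assoc_subset by auto
  finally show ?case .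
qed simp

lemma zero_in_set_pow_Suc: "0 \<in> U \<Longrightarrow> 0 \<in> set_pow_Suc U n"
  by (cases n) (auto intro: set_mult.intros)


subsection \<open>Elementary matrices\<close>

lemmas entry_simps = zero_fmat.rep_eq plus_fmat.rep_eq uminus_fmat.rep_eq elem_mat.rep_eq

lemma elem_mat_0 [simp]: "elem_mat 0 i j = 0"
  by (rule fmat_eqI) (simp add: entry_simps)

lemma elem_mat_eq_0_iff [simp]: "elem_mat a i j = 0 \<longleftrightarrow> a = 0"
  by (metis elem_mat.rep_eq elem_mat_0)

lemma elem_mat_add: "elem_mat (a + b) i j = elem_mat a i j + elem_mat b i j"
  for a b :: "'a::ring"
  by (rule fmat_eqI) (simp add: entry_simps)

lemma elem_mat_uminus: "elem_mat (- a) i j = - elem_mat a i j" for a :: "'a::ring"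
  by (rule fmat_eqI) (simp add: entry_simps)

lemma entry_elem_mat_times:
  fixes M :: "('i, 'a::ring) fmat"
  shows "entry (elem_mat a i j * M) k l = (if k = i then a * entry M j l else 0)"
  by (subst entry_times_superset[of "{j}"]) (auto simp: elem_mat.rep_eq)

lemma entry_times_elem_mat:
  fixes M :: "('i, 'a::ring) fmat"
  shows "entry (M * elem_mat a i j) k l = (if l = j then entry M k i * a else 0)"
proof (subst entry_times_superset[of "insert i {m. entry M k m \<noteq> 0}"])
  show "finite (insert i {m. entry M k m \<noteq> 0})" by (simp add: finite_entry_row)
  then show "(\<Sum>m\<in>insert i {m. entry M k m \<noteq> 0}. entry M k m * entry (elem_mat a i j) m l)
      = (if l = j then entry M k i * a else 0)"
    by (subst sum.mono_neutral_right[of _ "{i}"]) (auto simp: elem_mat.rep_eq)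
qed auto

lemma elem_mat_times_elem_mat:
  "elem_mat a i j * elem_mat b j k = elem_mat (a * b) i k" for a b :: "'a::ring"
  by (rule fmat_eqI) (simp add: entry_elem_mat_times elem_mat.rep_eq)

lemma entry_times_eq_0:
  fixes M N :: "('i, 'a::ring) fmat"
  assumes "\<And>k. entry M i k * entry N k j = 0"
  shows "entry (M * N) i j = 0"
  unfolding times_fmat.rep_eq using assms by (simp add: sum.neutral)

lemma pow_Suc_elem_mat: "pow_Suc (elem_mat a i i) n = elem_mat (pow_Suc a n) i i"
  for a :: "'a::ring"
  by (induction n) (simp_all add: elem_mat_times_elem_mat)

lemma elem_mat_in_UT_iff: "elem_mat a i j \<in> UT \<longleftrightarrow> i \<le> j \<or> a = 0"
  by (auto simp: UT_def elem_mat.rep_eq)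

lemma elem_mat_entry_in_UT: "M \<in> UT \<Longrightarrow> elem_mat (entry M i j) i j \<in> UT"
  unfolding elem_mat_in_UT_iff by (auto simp: UT_def)

text \<open>By antisymmetry i \<le> k \<le> i forces k = i, so one summand survives. Reading off a
  diagonal entry is therefore multiplicative on \<open>UT\<close>, which lets diagonal entries
  control both right ideals and powers.\<close>

lemma entry_times_UT_diag:
  assumes "M \<in> UT" "N \<in> UT"
  shows "entry (M * N) i i = entry M i i * entry N i i"
proof (subst entry_times_superset[of "insert i {k. entry M i k \<noteq> 0}"])
  let ?K = "insert i {k. entry M i k \<noteq> 0}"
  show fin: "finite ?K" by (simp add: finite_entry_row)
  have "entry M i k * entry N k i = 0" if "k \<noteq> i" for k
  proof -
    have "\<not> i \<le> k \<or> \<not> k \<le> i" using that by auto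
    then have "entry M i k = 0 \<or> entry N k i = 0" using assms unfolding UT_def by blast
    then show ?thesis by auto
  qed
  then show "(\<Sum>k\<in>?K. entry M i k * entry N k i) = entry M i i * entry N i i"
    using fin by (subst sum.mono_neutral_right[of _ "{i}"]) auto
qed auto

text \<open>A finitely supported matrix is the finite sum of its homogeneous parts.\<close>

lemma fmat_in_additive_set:
  fixes M :: "('i, 'a::ring) fmat"
  assumes "0 \<in> U" "\<And>x y. x \<in> U \<Longrightarrow> y \<in> U \<Longrightarrow> x + y \<in> U"
    and "\<And>i j. elem_mat (entry M i j) i j \<in> U"
  shows "M \<in> U"
proof -
  have fin: "finite {p. entry M (fst p) (snd p) \<noteq> 0}"
    using finite_entry[of M] by (simp add: case_prod_unfold)
  let ?f = "\<lambda>p. elem_mat (entry M (fst p) (snd p)) (fst p) (snd p)"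
  have M: "M = (\<Sum>p | entry M (fst p) (snd p) \<noteq> 0. ?f p)"
  proof (rule fmat_eqI)
    fix i j
    have "(\<Sum>p | entry M (fst p) (snd p) \<noteq> 0. entry (?f p) i j)
        = (\<Sum>p | entry M (fst p) (snd p) \<noteq> 0. if (i, j) = p then entry M i j else 0)"
      by (intro sum.cong) (auto simp: elem_mat.rep_eq)
    then show "entry M i j = entry (\<Sum>p | entry M (fst p) (snd p) \<noteq> 0. ?f p) i j"
      using fin by (simp add: entry_sum sum.delta)
  qed
  \<comment> \<open>For infinite \<open>S\<close> the sum is 0 by convention and lies in
    \<open>U\<close> as well.\<close>
  have "sum ?f S \<in> U" for S
    by (induction S rule: infinite_finite_induct) (use assms in auto)
  then show ?thesis by (subst M)
qed


subsection \<open>Graded right ideals of the ring of upper triangular matrices\<close>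

lemma elem_mat_in_UT_comp:
  "M \<in> UT \<Longrightarrow> elem_mat (entry M i j) i j \<in> UT_comp (i, j)"
  by (auto simp: UT_comp_iff elem_mat.rep_eq UT_def split: if_splits)

text \<open>The only candidate for the component of \<open>x\<close> at (i, j) is
  \<open>elem_mat (entry x i j) i j\<close>, so being graded means containing all these components.
  This replaces the bijection in the definition by a closure condition.\<close>

lemma graded_subset_UT_iff:
  fixes U :: "('i::order, 'a::ring_1) fmat set"
  assumes "U \<subseteq> UT" "0 \<in> U" "\<And>x y. x \<in> U \<Longrightarrow> y \<in> U \<Longrightarrow> x + y \<in> U"
  shows "graded_subset UT_comp U \<longleftrightarrow> (\<forall>x\<in>U. \<forall>i j. elem_mat (entry x i j) i j \<in> U)"
    (is "_ \<longleftrightarrow> ?R")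
proof -
  let ?s = "\<lambda>f :: 'i \<times> 'i \<Rightarrow> ('i, 'a) fmat. \<Sum>\<gamma> | f \<gamma> \<noteq> 0. f \<gamma>"
  let ?F = "{f :: 'i \<times> 'i \<Rightarrow> ('i, 'a) fmat. finite {\<gamma>. f \<gamma> \<noteq> 0} \<and> (\<forall>\<gamma>. f \<gamma> \<in> UT_comp \<gamma>)}"
  let ?F' = "{f. finite {\<gamma>. f \<gamma> \<noteq> 0} \<and> (\<forall>\<gamma>. f \<gamma> \<in> U \<inter> UT_comp \<gamma>)}"
  have s: "bij_betw ?s ?F UT"
    using internal_direct_sum_UT unfolding internal_direct_sum_def .
  \<comment> \<open>Uniqueness of decompositions is inherited from \<open>UT\<close>; only
    surjectivity onto \<open>U\<close> remains to be characterised.\<close>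
  have "inj_on ?s ?F'"
    by (rule inj_on_subset[OF bij_betw_imp_inj_on[OF s]]) auto
  then have "graded_subset UT_comp U \<longleftrightarrow> ?s ` ?F' = U"
    by (simp add: graded_subset_def internal_direct_sum_def bij_betw_def)
  also have "\<dots> \<longleftrightarrow> U \<subseteq> ?s ` ?F'"
  proof -
    have "sum f S \<in> U" if "\<forall>\<gamma>. f \<gamma> \<in> U" for f :: "'i \<times> 'i \<Rightarrow> ('i, 'a) fmat" and S
      by (induction S rule: infinite_finite_induct) (use assms that in auto)
    then have "?s ` ?F' \<subseteq> U" by blast
    then show ?thesis by auto
  qed
  also have "\<dots> \<longleftrightarrow> ?R"
  proof -
    have comp: "f (i, j) = elem_mat (entry (?s f) i j) i j" if "f \<in> ?F" for f i j
    proof -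
      have "f (i, j) \<in> UT_comp (i, j)" using that by blast
      moreover have "entry (?s f) i j = entry (f (i, j)) i j"
        using that by (intro entry_sum_UT_comp) auto
      ultimately show ?thesis
        by (intro fmat_eqI) (auto simp: UT_comp_iff elem_mat.rep_eq)
    qed
    have "x \<in> ?s ` ?F' \<longleftrightarrow> (\<forall>i j. elem_mat (entry x i j) i j \<in> U)" if x: "x \<in> U" for x
    proof -
      have "x \<in> ?s ` ?F" using bij_betw_imp_surj_on[OF s] x assms(1) by blast
      then obtain f where f: "f \<in> ?F" "x = ?s f" by blast
      show ?thesis
      proof
        assume "x \<in> ?s ` ?F'"
        then obtain g where g: "g \<in> ?F'" "x = ?s g" by blast
        then have "g \<in> ?F" by blast
        then have "g (i, j) = elem_mat (entry x i j) i j" for i j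
          using comp g(2) by blast
        then show "\<forall>i j. elem_mat (entry x i j) i j \<in> U"
          using g(1) by (metis (no_types, lifting) IntD1 mem_Collect_eq)
      next
        assume "\<forall>i j. elem_mat (entry x i j) i j \<in> U"
        then have "f (i, j) \<in> U" for i j using comp[OF f(1)] f(2) by metis
        then have "f \<in> ?F'" using f(1) by auto
        then show "x \<in> ?s ` ?F'" using f(2) by blast
      qed
    qed
    then show ?thesis by blast
  qed
  finally show ?thesis .
qed

lemma graded_right_ideal_UT_iff:
  "graded_right_ideal UT_comp UT U \<longleftrightarrow>
     right_ideal UT U \<and> (\<forall>x\<in>U. \<forall>i j. elem_mat (entry x i j) i j \<in> U)"
  unfolding graded_right_ideal_def
  by (rule conj_cong[OF refl], rule graded_subset_UT_iff) (auto simp: right_ideal_def)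

section \<open>Gr-maximal right ideals and diagonal positions\<close>

text \<open>The preimage of \<open>m\<close> under the multiplicative map from \<open>UT\<close> to
  its (k, k) entry; it transports right ideals of A to graded right ideals of
  \<open>UT\<close>.\<close>

definition diag_ideal :: "'i \<Rightarrow> 'a set \<Rightarrow> ('i::order, 'a::ring_1) fmat set" where
  "diag_ideal k m = {x \<in> UT. entry x k k \<in> m}"

lemma elem_mat_in_diag_ideal: "elem_mat a k k \<in> diag_ideal k m \<longleftrightarrow> a \<in> m"
  by (simp add: diag_ideal_def elem_mat_in_UT_iff elem_mat.rep_eq)

lemma graded_right_ideal_diag_ideal:
  assumes "right_ideal UNIV m"
  shows "graded_right_ideal UT_comp UT (diag_ideal k m)"
  unfolding graded_right_ideal_UT_iff
proof
  show "right_ideal UT (diag_ideal k m)"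
    using assms subring_UT
    by (auto simp: right_ideal_def diag_ideal_def subring_def entry_simps entry_times_UT_diag)
  show "\<forall>x\<in>diag_ideal k m. \<forall>i j. elem_mat (entry x i j) i j \<in> diag_ideal k m"
    using assms by (auto simp: diag_ideal_def elem_mat_entry_in_UT elem_mat.rep_eq right_ideal_def)
qed

lemma diag_ideal_eq_UT_iff: "diag_ideal k m = UT \<longleftrightarrow> m = UNIV"
proof
  assume "diag_ideal k m = UT"
  then have "a \<in> m" for a
    using elem_mat_in_diag_ideal[of a k m] elem_mat_in_UT_iff[of a k k] by simp
  then show "m = UNIV" by auto
qed (simp add: diag_ideal_def)

lemma diag_ideal_subset_iff: "diag_ideal k m \<subseteq> diag_ideal k n \<longleftrightarrow> m \<subseteq> n"
proof
  show "m \<subseteq> n" if "diag_ideal k m \<subseteq> diag_ideal k n"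
    using that elem_mat_in_diag_ideal by (metis subset_iff)
qed (auto simp: diag_ideal_def)

lemma diag_ideal_inject: "diag_ideal k m = diag_ideal k n \<longleftrightarrow> m = n"
  by (metis diag_ideal_subset_iff order_antisym order_refl)

text \<open>Multiplying a (k, k) entry by \<open>a\<close> is realised inside \<open>M\<close> by
  right multiplication with \<open>elem_mat a k k\<close>.\<close>

lemma right_ideal_diag_entries:
  assumes "right_ideal UT M"
  shows "right_ideal UNIV ((\<lambda>x. entry x k k) ` M)" (is "right_ideal _ ?m")
proof -
  have "entry x k k + entry y k k \<in> ?m" if "x \<in> M" "y \<in> M" for x y
    by (rule image_eqI[of _ _ "x + y"]) (use that assms in \<open>auto simp: right_ideal_def entry_simps\<close>)
  moreover have "- entry x k k \<in> ?m" if "x \<in> M" for x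
    by (rule image_eqI[of _ _ "- x"]) (use that assms in \<open>auto simp: right_ideal_def entry_simps\<close>)
  moreover have "entry x k k * a \<in> ?m" if "x \<in> M" for x a
    by (rule image_eqI[of _ _ "x * elem_mat a k k"])
      (use that assms in \<open>auto simp: right_ideal_def entry_times_elem_mat elem_mat_in_UT_iff\<close>)
  moreover have "0 \<in> ?m"
    by (rule image_eqI[of _ _ 0]) (use assms in \<open>auto simp: right_ideal_def entry_simps\<close>)
  ultimately show ?thesis by (auto simp: right_ideal_def)
qed

text \<open>The idempotents \<open>elem_mat 1 k k\<close> together generate \<open>UT\<close> as a
  right ideal, so a proper \<open>M\<close> misses one of them. At that position the entries of
  \<open>M\<close> form a proper right ideal of A.\<close>

lemma proper_graded_right_ideal_subset_diag_ideal:
  fixes M :: "('i::order, 'a::ring_1) fmat set"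
  assumes M: "graded_right_ideal UT_comp UT M" and ne: "M \<noteq> UT"
  obtains k m where "right_ideal UNIV m" "m \<noteq> UNIV" "M \<subseteq> diag_ideal k m"
proof -
  have r: "right_ideal UT M" and g: "\<And>x i j. x \<in> M \<Longrightarrow> elem_mat (entry x i j) i j \<in> M"
    using M by (auto simp: graded_right_ideal_UT_iff)
  have "\<exists>k. elem_mat 1 k k \<notin> M"
  proof (rule ccontr)
    assume "\<not> ?thesis"
    then have one: "elem_mat 1 k k \<in> M" for k by auto
    have "y \<in> M" if y: "y \<in> UT" for y
    proof (rule fmat_in_additive_set)
      fix i j
      \<comment> \<open>The idempotent of row i acts as a local left unit on the entries of that
        row.\<close>
      have "elem_mat 1 i i * elem_mat (entry y i j) i j \<in> M"
        using r one elem_mat_entry_in_UT[OF y] unfolding right_ideal_def by blast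
      then show "elem_mat (entry y i j) i j \<in> M" by (simp add: elem_mat_times_elem_mat)
    qed (use r in \<open>auto simp: right_ideal_def\<close>)
    then show False using ne r by (auto simp: right_ideal_def)
  qed
  then obtain k where k: "elem_mat 1 k k \<notin> M" ..
  let ?m = "(\<lambda>x. entry x k k) ` M"
  \<comment> \<open>If 1 were the (k, k) entry of some \<open>x\<close> in \<open>M\<close>,
    gradedness would put \<open>elem_mat 1 k k\<close> into \<open>M\<close>.\<close>
  have "1 \<notin> ?m" using k g by (metis (no_types, lifting) imageE)
  moreover have "M \<subseteq> diag_ideal k ?m" using r by (auto simp: diag_ideal_def right_ideal_def)
  ultimately show thesis using that[of ?m k] right_ideal_diag_entries[OF r] by blast
qed

lemma gr_maximal_right_ideal_UT_iff:
  fixes M :: "('i::order, 'a::ring_1) fmat set"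
  shows "gr_maximal_right_ideal UT_comp UT M \<longleftrightarrow>
    (\<exists>k m. maximal_right_ideal UNIV m \<and> M = diag_ideal k m)" (is "?L \<longleftrightarrow> ?R")
proof
  assume L: ?L
  then obtain k m where m: "right_ideal UNIV m" "m \<noteq> UNIV" and "M \<subseteq> diag_ideal k m"
    using proper_graded_right_ideal_subset_diag_ideal unfolding gr_maximal_right_ideal_def by metis
  \<comment> \<open>The enclosing \<open>diag_ideal k m\<close> is itself a proper graded right
    ideal, so maximality turns the inclusion into an equality.\<close>
  then have M: "M = diag_ideal k m"
    using L graded_right_ideal_diag_ideal diag_ideal_eq_UT_iff
    unfolding gr_maximal_right_ideal_def by metis
  have "n = m" if "right_ideal UNIV n" "n \<noteq> UNIV" "m \<subseteq> n" for n
    using L that graded_right_ideal_diag_ideal[OF that(1), of k]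
    unfolding gr_maximal_right_ideal_def M
    by (metis diag_ideal_eq_UT_iff diag_ideal_inject diag_ideal_subset_iff)
  then show ?R using m M unfolding maximal_right_ideal_def by blast
next
  assume ?R
  then obtain k m where m: "maximal_right_ideal UNIV m" and M: "M = diag_ideal k m" by blast
  have "N = M" if N: "graded_right_ideal UT_comp UT N" "N \<noteq> UT" "M \<subseteq> N" for N
  proof -
    obtain l n where n: "right_ideal UNIV n" "n \<noteq> UNIV" "N \<subseteq> diag_ideal l n"
      using proper_graded_right_ideal_subset_diag_ideal[OF N(1,2)] by metis
    have "1 \<notin> n" using n(1,2) unfolding right_ideal_def by (metis UNIV_I UNIV_eq_I mult_1)
    \<comment> \<open>For l distinct from k the idempotent at l has (k, k) entry 0, so it lies in
      \<open>M\<close> and hence in \<open>diag_ideal l n\<close>, which would force 1 into the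
      proper ideal \<open>n\<close>.\<close>
    have "l = k"
    proof (rule ccontr)
      assume "l \<noteq> k"
      then have "elem_mat 1 l l \<in> diag_ideal k m"
        using m by (auto simp: diag_ideal_def elem_mat_in_UT_iff elem_mat.rep_eq
            maximal_right_ideal_def right_ideal_def)
      then show False using \<open>1 \<notin> n\<close> M N(3) n(3) elem_mat_in_diag_ideal by blast
    qed
    then have "m \<subseteq> n" using M N(3) n(3) diag_ideal_subset_iff by blast
    then have "n = m" using m n by (auto simp: maximal_right_ideal_def)
    then show ?thesis using M N(3) n(3) \<open>l = k\<close> by blast
  qed
  then show ?L
    using m M graded_right_ideal_diag_ideal[of m k] diag_ideal_eq_UT_iff[of k m]
    by (auto simp: gr_maximal_right_ideal_def maximal_right_ideal_def)
qed

text \<open>Intersecting \<open>diag_ideal k m\<close> over all maximal \<open>m\<close> puts the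
  (k, k) entry into the radical of A; then k varies over all positions.\<close>

lemma gr_radical_UT:
  "gr_radical UT_comp (UT :: ('i::order, 'a::ring_1) fmat set)
     = {x \<in> UT. \<forall>i. entry x i i \<in> jacobson_radical}"
  by (auto simp: gr_radical_def gr_maximal_right_ideal_UT_iff jacobson_radical_def diag_ideal_def)

lemma right_ideal_jacobson_radical: "right_ideal UNIV jacobson_radical"
  by (auto simp: right_ideal_def jacobson_radical_def maximal_right_ideal_def)


subsection \<open>Powers of the graded radical\<close>

text \<open>Isolates what is used of the graded radical: diagonal entries restricted to a right
  ideal \<open>J\<close>. The theorem instantiates \<open>J\<close> with the Jacobson
  radical.\<close>

locale diag_restricted =
  fixes J :: "'a::ring_1 set" and U :: "('i::order, 'a) fmat set"
  assumes J: "right_ideal UNIV J"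
  assumes U_def: "U = {x \<in> UT. \<forall>i. entry x i i \<in> J}"
begin

lemma J_0 [simp]: "0 \<in> J"
  using J by (auto simp: right_ideal_def)

lemma zero_in_J_pow: "0 \<in> set_pow_Suc J n"
  by (simp add: zero_in_set_pow_Suc)

lemma zero_in_U: "0 \<in> U"
  by (simp add: U_def UT_def entry_simps)

lemma zero_in_U_pow: "0 \<in> set_pow_Suc U n"
  by (simp add: zero_in_set_pow_Suc zero_in_U)

section \<open>Nonzero elements of the powers\<close>

lemma elem_mat_in_U: "elem_mat a i j \<in> U" if "i < j \<or> i = j \<and> a \<in> J"
  using that by (auto simp: U_def elem_mat_in_UT_iff elem_mat.rep_eq)

text \<open>The map sending a to \<open>elem_mat a i i\<close> preserves sums and products, so
  nonzero elements of a power of \<open>J\<close> survive in the same power of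
  \<open>U\<close>.\<close>

lemma J_pow_in_U_pow: "a \<in> set_pow_Suc J n \<Longrightarrow> elem_mat a i i \<in> set_pow_Suc U n"
proof (induction n arbitrary: a)
  case 0
  then show ?case by (simp add: elem_mat_in_U)
next
  case (Suc n)
  from Suc.prems have "a \<in> set_mult (set_pow_Suc J n) J" by simp
  then have "elem_mat a i i \<in> set_mult (set_pow_Suc U n) U"
  proof induction
    case (prod u v)
    then have "elem_mat u i i * elem_mat v i i \<in> set_mult (set_pow_Suc U n) U"
      using Suc.IH by (intro set_mult.prod elem_mat_in_U) auto
    then show ?case by (simp add: elem_mat_times_elem_mat)
  qed (simp_all add: elem_mat_add elem_mat_uminus set_mult.intros)
  then show ?case by simp
qed

text \<open>Each strict step of a chain is an elementary matrix in \<open>U\<close>, and consecutive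
  ones multiply to the next. The n + 1 steps match the n + 1 factors; the last step is split off
  because powers grow on the right.\<close>

lemma chain_in_U_pow:
  "sorted_wrt (<) (i # ks) \<Longrightarrow> length ks = Suc n \<Longrightarrow> elem_mat 1 i (last ks) \<in> set_pow_Suc U n"
proof (induction n arbitrary: ks)
  case 0
  then obtain k where "ks = [k]" by (auto simp: length_Suc_conv)
  then show ?case using 0 by (simp add: elem_mat_in_U)
next
  case (Suc n)
  obtain ls l where ks: "ks = ls @ [l]" using Suc.prems by (cases ks rule: rev_cases) auto
  then have ls: "length ls = Suc n" "sorted_wrt (<) (i # ls)" "ls \<noteq> []"
    using Suc.prems by (auto simp: sorted_wrt_append)
  then have "last ls < l" using Suc.prems ks by (auto simp: sorted_wrt_append)
  then have "elem_mat 1 i (last ls) * elem_mat 1 (last ls) l \<in> set_mult (set_pow_Suc U n) U"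
    using Suc.IH ls by (intro set_mult.prod elem_mat_in_U) auto
  then show ?case by (simp add: ks elem_mat_times_elem_mat)
qed

section \<open>Vanishing of rows and columns in high powers\<close>

lemma U_pow: "set_pow_Suc U n \<subseteq> {x \<in> UT. \<forall>i. entry x i i \<in> set_pow_Suc J n}"
proof (induction n)
  case (Suc n)
  show ?case unfolding set_pow_Suc.simps(2)[of U]
  proof (rule set_mult_subset)
    fix x y assume "x \<in> set_pow_Suc U n" "y \<in> U"
    moreover from this have "x \<in> UT" "y \<in> UT" using Suc by (auto simp: U_def)
    ultimately show "x * y \<in> {x \<in> UT. \<forall>i. entry x i i \<in> set_pow_Suc J (Suc n)}"
      using subring_UT Suc
      by (auto simp: entry_times_UT_diag subring_def U_def intro!: set_mult.prod)
  qed (use subring_UT in \<open>auto simp: subring_def entry_simps intro: set_mult.intros\<close>)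
qed (simp add: U_def)

text \<open>A block of m + 1 factors has zero diagonal, so a nonzero entry in row i must pass
  through some k > i. With n such blocks a nonzero entry would trace a chain of n strict steps above
  i.\<close>

lemma row_U_pow_eq_0:
  assumes J: "set_pow_Suc J m = {0}" and "\<nexists>ks. length ks = n \<and> sorted_wrt (<) (i # ks)"
    and "x \<in> set_pow_Suc U (n * Suc m)"
  shows "entry x i j = 0"
  using assms(2,3)
proof (induction n arbitrary: i x)
  \<comment> \<open>The case n = 0 is vacuous, since the empty list is always a chain of that
    length.\<close>
  case (Suc n)
  have "set_mult (set_pow_Suc U m) (set_pow_Suc U (n * Suc m)) \<subseteq> {x. entry x i j = 0}"
  proof (rule set_mult_subset)
    fix x y assume x: "x \<in> set_pow_Suc U m" and y: "y \<in> set_pow_Suc U (n * Suc m)"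
    have x: "x \<in> UT" "entry x i i = 0" using x U_pow J by auto
    have "entry x i k * entry y k j = 0" for k
    proof (cases "i < k")
      case True
      have "\<nexists>ks. length ks = n \<and> sorted_wrt (<) (k # ks)"
      proof
        assume "\<exists>ks. length ks = n \<and> sorted_wrt (<) (k # ks)"
        then obtain ks where ks: "length ks = n" "sorted_wrt (<) (k # ks)" by blast
        then have "sorted_wrt (<) (i # k # ks)" using True by auto
        then show False using Suc.prems(1) ks(1) by (metis length_Cons)
      qed
      then have "entry y k j = 0" using Suc.IH y by blast
      then show ?thesis by simp
    next
      case False
      then have "k = i \<or> \<not> i \<le> k" by auto
      then show ?thesis using x by (auto simp: UT_def)
    qed
    then show "x * y \<in> {x. entry x i j = 0}" by (simp add: entry_times_eq_0)
  qed (auto simp: entry_simps)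
  \<comment> \<open>In ordinary exponents (n + 1)(m + 1) + 1 splits into m + 1 and n(m + 1) + 1, the
    block being cut off on the left.\<close>
  moreover have "Suc n * Suc m = Suc (m + n * Suc m)" by simp
  then have "x \<in> set_pow_Suc U (Suc (m + n * Suc m))" using Suc.prems(2) by metis
  ultimately show ?case using set_pow_Suc_add_subset by blast
qed simp

text \<open>Mirror image of \<open>row_U_pow_eq_0\<close>: blocks are cut off on the right, and the
  chain descends from j.\<close>

lemma column_U_pow_eq_0:
  assumes J: "set_pow_Suc J m = {0}" and "\<nexists>ks. length ks = n \<and> sorted_wrt (<) (ks @ [j])"
    and "x \<in> set_pow_Suc U (n * Suc m)"
  shows "entry x i j = 0"
  using assms(2,3)
proof (induction n arbitrary: j x)
  case (Suc n)
  have "set_mult (set_pow_Suc U (n * Suc m)) (set_pow_Suc U m) \<subseteq> {x. entry x i j = 0}"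
  proof (rule set_mult_subset)
    fix x y assume x: "x \<in> set_pow_Suc U (n * Suc m)" and y: "y \<in> set_pow_Suc U m"
    have y: "y \<in> UT" "entry y j j = 0" using y U_pow J by auto
    have "entry x i k * entry y k j = 0" for k
    proof (cases "k < j")
      case True
      have "\<nexists>ks. length ks = n \<and> sorted_wrt (<) (ks @ [k])"
      proof
        assume "\<exists>ks. length ks = n \<and> sorted_wrt (<) (ks @ [k])"
        then obtain ks where ks: "length ks = n" "sorted_wrt (<) (ks @ [k])" by blast
        then have "sorted_wrt (<) ((ks @ [k]) @ [j])" using True by (auto simp: sorted_wrt_append)
        then show False using Suc.prems(1) ks(1) by (metis length_append_singleton)
      qed
      then have "entry x i k = 0" using Suc.IH x by blast
      then show ?thesis by simp
    next
      case False
      then have "k = j \<or> \<not> k \<le> j" by auto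
      then show ?thesis using y by (auto simp: UT_def)
    qed
    then show "x * y \<in> {x. entry x i j = 0}" by (simp add: entry_times_eq_0)
  qed (auto simp: entry_simps)
  moreover have "Suc n * Suc m = Suc (n * Suc m + m)" by simp
  then have "x \<in> set_pow_Suc U (Suc (n * Suc m + m))" using Suc.prems(2) by metis
  ultimately show ?case using set_pow_Suc_add_subset by blast
qed simp

lemma J_pow_eq_0I:
  assumes "\<And>a. a \<in> set_pow_Suc J n \<Longrightarrow> a = 0"
  shows "nilpotent_ideal J"
  using assms zero_in_J_pow[of n] unfolding nilpotent_ideal_def by blast

section \<open>The five equivalences\<close>

text \<open>Off-diagonal homogeneous elements square to zero, while powers of
  \<open>elem_mat a i i\<close> are those of \<open>a\<close> placed at (i, i).\<close>

lemma gr_nil_iff: "gr_nil UT_comp U \<longleftrightarrow> nil_ideal J"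
proof
  assume nil: "gr_nil UT_comp U"
  show "nil_ideal J" unfolding nil_ideal_def
  proof
    fix a assume "a \<in> J"
    \<comment> \<open>Types are nonempty, so an index is available.\<close>
    fix i :: 'i
    have "homogeneous UT_comp (elem_mat a i i)"
      unfolding homogeneous_def by (intro UN_I[of "(i, i)"]) (auto simp: UT_comp_def)
    moreover have "elem_mat a i i \<in> U" using \<open>a \<in> J\<close> by (simp add: elem_mat_in_U)
    ultimately have "nilpotent_element (elem_mat a i i)" using nil unfolding gr_nil_def by blast
    then show "nilpotent_element a" by (simp add: nilpotent_element_def pow_Suc_elem_mat)
  qed
next
  assume nil: "nil_ideal J"
  show "gr_nil UT_comp U" unfolding gr_nil_def
  proof (intro ballI impI)
    fix x assume x: "x \<in> U" and "homogeneous UT_comp x"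
    then consider "x = 0" | a i j where "x = elem_mat a i j" "i \<le> j"
      by (auto simp: homogeneous_def UT_comp_def split: if_splits)
    then show "nilpotent_element x"
    proof cases
      case 1
      then have "pow_Suc x 0 = 0" by simp
      then show ?thesis unfolding nilpotent_element_def ..
    next
      case 2
      show ?thesis
      proof (cases "i = j")
        case True
        then have "entry x i i = a" using 2 by (simp add: elem_mat.rep_eq)
        then have "a \<in> J" using x by (auto simp: U_def)
        then show ?thesis using nil True 2
          by (auto simp: nil_ideal_def nilpotent_element_def pow_Suc_elem_mat)
      next
        case False
        then have "pow_Suc x 1 = 0"
          by (intro fmat_eqI)
            (simp add: 2 entry_elem_mat_times entry_simps)
        then show ?thesis unfolding nilpotent_element_def ..
      qed
    qed
  qed
qed

text \<open>Matrices supported in row i multiply through their (i, i) entries alone, so strict steps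
  leave no trace there. This is why no chain condition enters the criterion for
  \<open>\<Gamma>\<^sub>0_nilpotent\<close>.\<close>

lemma row_pow:
  "set_pow_Suc ((\<lambda>x. elem_mat 1 i i * x) ` U) n
     \<subseteq> {x. (\<forall>k j. k \<noteq> i \<longrightarrow> entry x k j = 0) \<and> entry x i i \<in> set_pow_Suc J n}"
proof (induction n)
  case 0
  then show ?case by (auto simp: entry_elem_mat_times U_def)
next
  case (Suc n)
  show ?case unfolding set_pow_Suc.simps(2)[of "_ ` U"]
  proof (rule set_mult_subset)
    fix x y assume x: "x \<in> set_pow_Suc ((\<lambda>x. elem_mat 1 i i * x) ` U) n"
      and y: "y \<in> (\<lambda>x. elem_mat 1 i i * x) ` U"
    have x: "\<And>k j. k \<noteq> i \<Longrightarrow> entry x k j = 0" "entry x i i \<in> set_pow_Suc J n" using x Suc by auto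
    have y: "\<And>k j. k \<noteq> i \<Longrightarrow> entry y k j = 0" "entry y i i \<in> J"
      using y by (auto simp: entry_elem_mat_times U_def)
    \<comment> \<open>Column i of \<open>y\<close> is zero outside row i.\<close>
    have "entry (x * y) i i = entry (x * elem_mat (entry y i i) i i) i i"
      unfolding times_fmat.rep_eq by (rule sum.cong) (use y in \<open>auto simp: elem_mat.rep_eq\<close>)
    then have "entry (x * y) i i \<in> set_mult (set_pow_Suc J n) J"
      using x y by (simp add: entry_times_elem_mat set_mult.prod)
    then show "x * y \<in> {x. (\<forall>k j. k \<noteq> i \<longrightarrow> entry x k j = 0)
        \<and> entry x i i \<in> set_pow_Suc J (Suc n)}"
      using x(1) by (simp add: entry_times_eq_0)
  qed (auto simp: entry_simps intro: set_mult.intros)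
qed

lemma J_pow_in_row_pow:
  "a \<in> set_pow_Suc J n \<Longrightarrow> elem_mat a i i \<in> set_pow_Suc ((\<lambda>x. elem_mat 1 i i * x) ` U) n"
proof (induction n arbitrary: a)
  case 0
  then show ?case
    using elem_mat_in_U[of i i a] by (auto simp: elem_mat_times_elem_mat intro!: image_eqI)
next
  case (Suc n)
  let ?V = "(\<lambda>x. elem_mat 1 i i * x) ` U"
  from Suc.prems have "a \<in> set_mult (set_pow_Suc J n) J" by simp
  then have "elem_mat a i i \<in> set_mult (set_pow_Suc ?V n) ?V"
  proof induction
    case (prod u v)
    have "elem_mat v i i \<in> ?V" using prod elem_mat_in_U[of i i v]
      by (auto simp: elem_mat_times_elem_mat intro!: image_eqI)
    then have "elem_mat u i i * elem_mat v i i \<in> set_mult (set_pow_Suc ?V n) ?V"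
      using Suc.IH prod by (intro set_mult.prod) auto
    then show ?case by (simp add: elem_mat_times_elem_mat)
  qed (simp_all add: elem_mat_add elem_mat_uminus set_mult.intros)
  then show ?case by simp
qed

lemma \<Gamma>\<^sub>0_nilpotent_iff: "\<Gamma>\<^sub>0_nilpotent pair_objects UT_one U \<longleftrightarrow> nilpotent_ideal J"
proof -
  have *: "\<Gamma>\<^sub>0_nilpotent pair_objects UT_one U
      \<longleftrightarrow> (\<forall>i. \<exists>n. set_pow_Suc ((\<lambda>x. elem_mat 1 i i * x) ` U) n = {0})"
    by (auto simp: \<Gamma>\<^sub>0_nilpotent_def pair_objects_def UT_one_def)
  show ?thesis unfolding *
  proof
    fix i :: 'i
    assume "\<forall>i. \<exists>n. set_pow_Suc ((\<lambda>x. elem_mat 1 i i * x) ` U) n = {0}"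
    then obtain n where n: "set_pow_Suc ((\<lambda>x. elem_mat 1 i i * x) ` U) n = {0}"
      by blast
    show "nilpotent_ideal J"
    proof (rule J_pow_eq_0I)
      fix a assume "a \<in> set_pow_Suc J n"
      then show "a = 0" using J_pow_in_row_pow[of a n i] n by simp
    qed
  next
    assume "nilpotent_ideal J"
    then obtain m where m: "set_pow_Suc J m = {0}" by (auto simp: nilpotent_ideal_def)
    show "\<forall>i. \<exists>n. set_pow_Suc ((\<lambda>x. elem_mat 1 i i * x) ` U) n = {0}"
    proof
      fix i
      let ?V = "(\<lambda>x. elem_mat 1 i i * x) ` U"
      \<comment> \<open>After m + 1 factors the (i, i) entry is zero but the rest of row i may not
        be. One more factor, again supported in row i, sees only that zero entry.\<close>
      have "set_mult (set_pow_Suc ?V m) ?V \<subseteq> {0}"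
      proof (rule set_mult_subset)
        fix x y assume "x \<in> set_pow_Suc ?V m" and y: "y \<in> ?V"
        then have x: "\<And>k j. k \<noteq> i \<Longrightarrow> entry x k j = 0" "entry x i i = 0"
          using row_pow[of i m] m by auto
        have "entry x l k * entry y k j = 0" for l k j
          using x y by (cases "l = i"; cases "k = i") (auto simp: entry_elem_mat_times)
        then show "x * y \<in> {0}"
          by (auto intro!: fmat_eqI simp: entry_times_eq_0 zero_fmat.rep_eq)
      qed auto
      then have "set_pow_Suc ?V (Suc m) = {0}" by (auto intro: set_mult.zero)
      then show "\<exists>n. set_pow_Suc ?V n = {0}" ..
    qed
  qed
qed

lemma right_objectwise_nilpotent_iff:
  "right_objectwise_nilpotent pair_objects UT_one U \<longleftrightarrow>
     nilpotent_ideal J \<and> (\<forall>i::'i. \<exists>n. \<nexists>ks. length ks = n \<and> sorted_wrt (<) (i # ks))"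
proof -
  have "(\<lambda>x. elem_mat 1 i i * x) ` set_pow_Suc U n = {0}
      \<longleftrightarrow> (\<forall>x\<in>set_pow_Suc U n. \<forall>j. entry x i j = 0)" for i n
  proof -
    have "elem_mat 1 i i * x = 0 \<longleftrightarrow> (\<forall>j. entry x i j = 0)" for x :: "('i, 'a) fmat"
      unfolding entry_inject[symmetric] fun_eq_iff
      by (auto simp: entry_elem_mat_times zero_fmat.rep_eq)
    moreover have "(\<lambda>x. elem_mat 1 i i * x) ` set_pow_Suc U n = {0}
        \<longleftrightarrow> (\<forall>x\<in>set_pow_Suc U n. elem_mat 1 i i * x = 0)"
      using zero_in_U_pow[of n] by force
    ultimately show ?thesis by simp
  qed
  then have *: "right_objectwise_nilpotent pair_objects UT_one U
      \<longleftrightarrow> (\<forall>i. \<exists>n. \<forall>x\<in>set_pow_Suc U n. \<forall>j. entry x i j = 0)"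
    by (auto simp: right_objectwise_nilpotent_def pair_objects_def UT_one_def)
  show ?thesis unfolding *
  proof (intro iffI conjI allI)
    fix i :: 'i
    assume "\<forall>i. \<exists>n. \<forall>x\<in>set_pow_Suc U n. \<forall>j. entry x i j = 0"
    then obtain n where n: "\<And>x j. x \<in> set_pow_Suc U n \<Longrightarrow> entry x i j = 0" by blast
    \<comment> \<open>A chain of n + 1 steps from i would place the entry 1 in row i of a matrix in
      the vanishing power.\<close>
    have "\<not> sorted_wrt (<) (i # ks)" if "length ks = Suc n" for ks
      using n[OF chain_in_U_pow[OF _ that], of i "last ks"] by (auto simp: elem_mat.rep_eq)
    then show "\<exists>n. \<nexists>ks. length ks = n \<and> sorted_wrt (<) (i # ks)" by blast
  next
    fix i :: 'i
    assume "\<forall>i. \<exists>n. \<forall>x\<in>set_pow_Suc U n. \<forall>j. entry x i j = 0"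
    then obtain n where n: "\<And>x j. x \<in> set_pow_Suc U n \<Longrightarrow> entry x i j = 0" by blast
    show "nilpotent_ideal J"
    proof (rule J_pow_eq_0I)
      fix a assume "a \<in> set_pow_Suc J n"
      then show "a = 0" using n[OF J_pow_in_U_pow[of a n i], of i] by (simp add: elem_mat.rep_eq)
    qed
  next
    fix i :: 'i
    assume "nilpotent_ideal J \<and> (\<forall>i::'i. \<exists>n. \<nexists>ks. length ks = n \<and> sorted_wrt (<) (i # ks))"
    then obtain m n where "set_pow_Suc J m = {0}"
      and "\<nexists>ks. length ks = n \<and> sorted_wrt (<) (i # ks)"
      unfolding nilpotent_ideal_def by (elim conjE exE allE[of _ i])
    \<comment> \<open>The exponent allows n blocks of m + 1 factors, each costing a strict step away
      from i.\<close>
    then have "\<forall>x\<in>set_pow_Suc U (n * Suc m). \<forall>j. entry x i j = 0"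
      using row_U_pow_eq_0 by blast
    then show "\<exists>n. \<forall>x\<in>set_pow_Suc U n. \<forall>j. entry x i j = 0" ..
  qed
qed

lemma left_objectwise_nilpotent_iff:
  "left_objectwise_nilpotent pair_objects UT_one U \<longleftrightarrow>
     nilpotent_ideal J \<and> (\<forall>j::'i. \<exists>n. \<nexists>ks. length ks = n \<and> sorted_wrt (<) (ks @ [j]))"
proof -
  have "(\<lambda>x. x * elem_mat 1 j j) ` set_pow_Suc U n = {0}
      \<longleftrightarrow> (\<forall>x\<in>set_pow_Suc U n. \<forall>i. entry x i j = 0)" for j n
  proof -
    have "x * elem_mat 1 j j = 0 \<longleftrightarrow> (\<forall>i. entry x i j = 0)" for x :: "('i, 'a) fmat"
      unfolding entry_inject[symmetric] fun_eq_iff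
      by (auto simp: entry_times_elem_mat zero_fmat.rep_eq)
    moreover have "(\<lambda>x. x * elem_mat 1 j j) ` set_pow_Suc U n = {0}
        \<longleftrightarrow> (\<forall>x\<in>set_pow_Suc U n. x * elem_mat 1 j j = 0)"
      using zero_in_U_pow[of n] by force
    ultimately show ?thesis by simp
  qed
  then have *: "left_objectwise_nilpotent pair_objects UT_one U
      \<longleftrightarrow> (\<forall>j. \<exists>n. \<forall>x\<in>set_pow_Suc U n. \<forall>i. entry x i j = 0)"
    by (auto simp: left_objectwise_nilpotent_def pair_objects_def UT_one_def)
  show ?thesis unfolding *
  proof (intro iffI conjI allI)
    fix j :: 'i
    assume "\<forall>j. \<exists>n. \<forall>x\<in>set_pow_Suc U n. \<forall>i. entry x i j = 0"
    then obtain n where n: "\<And>x i. x \<in> set_pow_Suc U n \<Longrightarrow> entry x i j = 0" by blast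
    have "\<not> sorted_wrt (<) (ks @ [j])" if len: "length ks = Suc n" for ks
    proof
      assume s: "sorted_wrt (<) (ks @ [j])"
      obtain i ls where ks: "ks = i # ls" using len by (cases ks) auto
      \<comment> \<open>The chain is reread from its bottom element i, so \<open>ls @ [j]\<close>
        again has n + 1 elements and ends in j.\<close>
      then have "elem_mat 1 i (last (ls @ [j])) \<in> set_pow_Suc U n"
        using s len by (intro chain_in_U_pow) auto
      from n[OF this, of i] show False by (simp add: elem_mat.rep_eq)
    qed
    then show "\<exists>n. \<nexists>ks. length ks = n \<and> sorted_wrt (<) (ks @ [j])" by blast
  next
    fix j :: 'i
    assume "\<forall>j. \<exists>n. \<forall>x\<in>set_pow_Suc U n. \<forall>i. entry x i j = 0"
    then obtain n where n: "\<And>x i. x \<in> set_pow_Suc U n \<Longrightarrow> entry x i j = 0" by blast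
    show "nilpotent_ideal J"
    proof (rule J_pow_eq_0I)
      fix a assume "a \<in> set_pow_Suc J n"
      then show "a = 0" using n[OF J_pow_in_U_pow[of a n j], of j] by (simp add: elem_mat.rep_eq)
    qed
  next
    fix j :: 'i
    assume "nilpotent_ideal J \<and> (\<forall>j::'i. \<exists>n. \<nexists>ks. length ks = n \<and> sorted_wrt (<) (ks @ [j]))"
    then obtain m n where "set_pow_Suc J m = {0}"
      and "\<nexists>ks. length ks = n \<and> sorted_wrt (<) (ks @ [j])"
      unfolding nilpotent_ideal_def by (elim conjE exE allE[of _ j])
    then have "\<forall>x\<in>set_pow_Suc U (n * Suc m). \<forall>i. entry x i j = 0"
      using column_U_pow_eq_0 by blast
    then show "\<exists>n. \<forall>x\<in>set_pow_Suc U n. \<forall>i. entry x i j = 0" ..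
  qed
qed

lemma nilpotent_ideal_iff:
  "nilpotent_ideal U \<longleftrightarrow>
     nilpotent_ideal J \<and> (\<exists>t. \<nexists>ks::'i list. length ks = Suc t \<and> sorted_wrt (<) ks)"
proof (intro iffI conjI)
  assume "nilpotent_ideal U"
  then obtain n where n: "set_pow_Suc U n = {0}" by (auto simp: nilpotent_ideal_def)
  show "nilpotent_ideal J"
    by (rule J_pow_eq_0I[of n]) (use J_pow_in_U_pow n in fastforce)
  \<comment> \<open>A chain of n + 2 elements has n + 1 steps, one for each factor.\<close>
  have "\<not> sorted_wrt (<) ks" if len: "length ks = Suc (Suc n)" for ks :: "'i list"
  proof
    assume s: "sorted_wrt (<) ks"
    obtain i ls where "ks = i # ls" using len by (cases ks) auto
    then have "elem_mat 1 i (last ls) \<in> set_pow_Suc U n"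
      using s len by (intro chain_in_U_pow) auto
    then show False using n by simp
  qed
  then show "\<exists>t. \<nexists>ks::'i list. length ks = Suc t \<and> sorted_wrt (<) ks" by blast
next
  assume "nilpotent_ideal J \<and> (\<exists>t. \<nexists>ks::'i list. length ks = Suc t \<and> sorted_wrt (<) ks)"
  then obtain m t where m: "set_pow_Suc J m = {0}"
    and t: "\<nexists>ks::'i list. length ks = Suc t \<and> sorted_wrt (<) ks"
    unfolding nilpotent_ideal_def by blast
  \<comment> \<open>The bound t is the same for every starting point, so a single exponent kills all
    rows at once.\<close>
  have "x = 0" if x: "x \<in> set_pow_Suc U (t * Suc m)" for x
  proof (rule fmat_eqI)
    fix i j :: 'i
    have "\<nexists>ks. length ks = t \<and> sorted_wrt (<) (i # ks)" using t by (metis length_Cons)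
    then show "entry x i j = entry 0 i j"
      using row_U_pow_eq_0[OF m _ x] by (simp add: zero_fmat.rep_eq)
  qed
  then show "nilpotent_ideal U"
    using zero_in_U_pow unfolding nilpotent_ideal_def by blast
qed

end

theorem proposition6p3:
  fixes U :: "('i::order, 'a::ring_1) fmat set" and J :: "'a set"
  assumes U: "U = gr_radical UT_comp UT" and J: "J = jacobson_radical"
  shows
    "(gr_nil UT_comp U \<longleftrightarrow> nil_ideal J) \<and>
     (\<Gamma>\<^sub>0_nilpotent pair_objects UT_one U \<longleftrightarrow> nilpotent_ideal J) \<and>
     (right_objectwise_nilpotent pair_objects UT_one U \<longleftrightarrow>
        nilpotent_ideal J \<and>
        (\<forall>i::'i. \<exists>n. \<nexists>ks. length ks = n \<and> sorted_wrt (<) (i # ks))) \<and>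
     (left_objectwise_nilpotent pair_objects UT_one U \<longleftrightarrow>
        nilpotent_ideal J \<and>
        (\<forall>j::'i. \<exists>n. \<nexists>ks. length ks = n \<and> sorted_wrt (<) (ks @ [j]))) \<and>
     (nilpotent_ideal U \<longleftrightarrow>
        nilpotent_ideal J \<and>
        (\<exists>t. \<nexists>ks::'i list. length ks = Suc t \<and> sorted_wrt (<) ks))"
proof -
  interpret diag_restricted J U
    using U J right_ideal_jacobson_radical by unfold_locales (auto simp: gr_radical_UT)
  show ?thesis
    using gr_nil_iff \<Gamma>\<^sub>0_nilpotent_iff right_objectwise_nilpotent_iff
      left_objectwise_nilpotent_iff nilpotent_ideal_iff by blast
qed

end
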